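(* For every $n\ge1$, the number of binary words $w$ (of any length $m\ge1$) with no two consecutive $1$'s such that $\mathrm{area}(P(w))=n$ equals $b_{n+1}$, where $(b_m)_{m\ge0}$ is Narayana's cows sequence defined by $b_0=b_1=b_2=1$ and $b_m=b_{m-1}+b_{m-3}$ for $m\ge3$ (equivalently $\sum_{m\ge0}b_mx^m=1/(1-x-x^3)$).
   Context: For a binary word $w=w_1\cdots w_m$, $P(w)$ is the bargraph polyomino whose $i$-th column consists of $w_i+1$ unit cells, and $\mathrm{area}(P(w))$ is its number of cells, i.e. $m+w_1+\dots+w_m$. *)

theory Defs
  imports Main "HOL-Computational_Algebra.Formal_Power_Series"
begin

definition binary_word :: "nat list \<Rightarrow> bool" where
  "binary_word w \<longleftrightarrow> set w \<subseteq> {0, 1}"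

definition no_consecutive_ones :: "nat list \<Rightarrow> bool" where
  "no_consecutive_ones w \<longleftrightarrow>
     (\<forall>i. Suc i < length w \<longrightarrow> \<not> (w ! i = 1 \<and> w ! Suc i = 1))"

text \<open>A polyomino is represented by its set of unit cells, a cell being identified with the
  coordinates of its lower left corner; columns and rows are numbered from 0.\<close>

definition bargraph :: "nat list \<Rightarrow> (nat \<times> nat) set" where
  "bargraph w = {(i, j). i < length w \<and> j < w ! i + 1}"

definition area :: "(nat \<times> nat) set \<Rightarrow> nat" where
  "area P = card P"

lemma area_bargraph: "area (bargraph w) = length w + sum_list w"
proof -
  have "bargraph w = (SIGMA i:{..<length w}. {..<w ! i + 1})"
    by (auto simp: bargraph_def)
  then show ?thesis
    by (simp add: area_def sum_list_sum_nth atLeast0LessThan sum_Suc)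
qed

fun narayana :: "nat \<Rightarrow> nat" where
  "narayana 0 = 1"
| "narayana (Suc 0) = 1"
| "narayana (Suc (Suc 0)) = 1"
| "narayana (Suc (Suc (Suc m))) = narayana (Suc (Suc m)) + narayana m"

lemma narayana_rec: "m \<ge> 3 \<Longrightarrow> narayana m = narayana (m - 1) + narayana (m - 3)"
  by (cases m rule: narayana.cases) auto

end

theory Submission
  imports Defs
begin

text \<open>A nonempty admissible word starts with \<open>0\<close>, is the word \<open>1\<close>, or starts with \<open>10\<close>; the
  prefix \<open>0\<close> contributes area \<open>1\<close> and the prefix \<open>10\<close> contributes area \<open>3\<close>, and what follows
  either prefix is an arbitrary admissible word. This is the recurrence of \<^const>\<open>narayana\<close>,
  shifted by one.\<close>

lemma binary_word_simps [simp]: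
  "binary_word []"
  "binary_word (x # w) \<longleftrightarrow> x \<in> {0, 1} \<and> binary_word w"
  by (auto simp: binary_word_def)

lemma no_consecutive_ones_Nil [simp]: "no_consecutive_ones []"
  by (simp add: no_consecutive_ones_def)

lemma no_consecutive_ones_single [simp]: "no_consecutive_ones [x]"
  by (simp add: no_consecutive_ones_def)

lemma no_consecutive_ones_Cons_Cons [simp]:
  "no_consecutive_ones (x # y # w) \<longleftrightarrow> \<not> (x = 1 \<and> y = 1) \<and> no_consecutive_ones (y # w)"
  by (simp add: no_consecutive_ones_def All_less_Suc2)

lemma no_consecutive_ones_Cons_0 [simp]:
  "no_consecutive_ones (0 # w) \<longleftrightarrow> no_consecutive_ones w"
  by (cases w) auto

definition words_of_area :: "nat \<Rightarrow> nat list set" where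
  "words_of_area n = {w. binary_word w \<and> no_consecutive_ones w \<and> length w + sum_list w = n}"

lemma words_of_area_0: "words_of_area 0 = {[]}"
  by (auto simp: words_of_area_def)

text \<open>A \<open>1\<close> is either the last letter or followed by \<open>0\<close>, and a
  \<open>0\<close> puts no constraint on what follows it. The lower bounds on \<open>n\<close> guard
  against truncated subtraction.\<close>

lemma Cons_in_words_of_area_iff:
  "x # w \<in> words_of_area n \<longleftrightarrow>
     (x = 0 \<and> n \<ge> 1 \<and> w \<in> words_of_area (n - 1)) \<or>
     (x = 1 \<and> w = [] \<and> n = 2) \<or>
     (x = 1 \<and> n \<ge> 3 \<and> (\<exists>v. w = 0 # v \<and> v \<in> words_of_area (n - 3)))"
  by (cases w) (auto simp: words_of_area_def)

lemma words_of_area_1: "words_of_area (Suc 0) = {[0]}"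
proof (rule set_eqI)
  fix w show "w \<in> words_of_area (Suc 0) \<longleftrightarrow> w \<in> {[0]}"
    by (cases w) (auto simp: Cons_in_words_of_area_iff words_of_area_0, auto simp: words_of_area_def)
qed

lemma words_of_area_2: "words_of_area 2 = {[0, 0], [1]}"
proof (rule set_eqI)
  fix w show "w \<in> words_of_area 2 \<longleftrightarrow> w \<in> {[0, 0], [1]}"
    by (cases w) (auto simp: Cons_in_words_of_area_iff words_of_area_1, auto simp: words_of_area_def)
qed

text \<open>From area 3 on, the exceptional words \<open>[]\<close> and \<open>[1]\<close>, of areas
  0 and 2, no longer occur.\<close>

lemma words_of_area_rec:
  "words_of_area (n + 3) = (#) 0 ` words_of_area (n + 2) \<union> (\<lambda>w. 1 # 0 # w) ` words_of_area n"
proof (rule set_eqI)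
  fix w
  have "[] \<notin> words_of_area (n + 3)" by (simp add: words_of_area_def)
  then show "w \<in> words_of_area (n + 3) \<longleftrightarrow>
      w \<in> (#) 0 ` words_of_area (n + 2) \<union> (\<lambda>w. 1 # 0 # w) ` words_of_area n"
    by (cases w) (auto simp: Cons_in_words_of_area_iff)
qed

text \<open>Finiteness is carried through the induction because the cardinality of a disjoint union
  requires it.\<close>

lemma finite_card_words_of_area:
  "finite (words_of_area n) \<and> card (words_of_area n) = narayana (Suc n)"
proof (induction n rule: narayana.induct)
  case (4 n)
  have "card (words_of_area (n + 3)) = card ((#) 0 ` words_of_area (n + 2))
      + card ((\<lambda>w. 1 # 0 # w) ` words_of_area n)"
    \<comment> \<open>The two images are disjoint because their words differ in the first
      letter.\<close>
    unfolding words_of_area_rec using 4 by (intro card_Un_disjoint) auto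
  also have "\<dots> = card (words_of_area (n + 2)) + card (words_of_area n)"
    by (simp add: card_image inj_on_def)
  finally show ?case
    using 4 words_of_area_rec[of n] by (simp add: numeral_3_eq_3)
qed (simp_all add: words_of_area_0 words_of_area_1 words_of_area_2[unfolded numeral_2_eq_2])

lemma narayana_fps: "Abs_fps (\<lambda>m. of_nat (narayana m) :: 'a :: field) = 1 / (1 - fps_X - fps_X ^ 3)"
proof -
  let ?F = "Abs_fps (\<lambda>m. of_nat (narayana m) :: 'a)"
  have "?F = 1 + fps_X * ?F + fps_X ^ 3 * ?F"
  proof (rule fps_ext)
    fix n show "fps_nth ?F n = fps_nth (1 + fps_X * ?F + fps_X ^ 3 * ?F) n"
      \<comment> \<open>At degree 0 only the summand 1 contributes, at degrees 1 and 2 only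
        \<open>fps_X * ?F\<close>; from degree 3 on the equation is the recurrence.\<close>
      by (cases n rule: narayana.cases) (auto simp: fps_X_power_mult_nth)
  qed
  then have "?F * (1 - fps_X - fps_X ^ 3) = 1"
    by (simp add: algebra_simps)
  \<comment> \<open>A zero factor would make the product 0 instead of 1.\<close>
  moreover from this have "1 - fps_X - fps_X ^ 3 \<noteq> (0 :: 'a fps)" by auto
  ultimately show ?thesis
    by (metis nonzero_mult_div_cancel_right)
qed

theorem theorem1p5:
  shows "(\<forall>n\<ge>1. card {w. length w \<ge> 1 \<and> binary_word w \<and> no_consecutive_ones w
                        \<and> area (bargraph w) = n} = narayana (n + 1))
       \<and> Abs_fps (\<lambda>m. of_nat (narayana m) :: rat) = 1 / (1 - fps_X - fps_X ^ 3)"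
proof (intro conjI allI impI)
  fix n :: nat assume "n \<ge> 1"
  \<comment> \<open>The empty word has area 0, so \<open>n \<ge> 1\<close> excludes it.\<close>
  then have "{w. length w \<ge> 1 \<and> binary_word w \<and> no_consecutive_ones w
      \<and> area (bargraph w) = n} = words_of_area n"
    by (auto simp: words_of_area_def area_bargraph Suc_le_eq)
  then show "card {w. length w \<ge> 1 \<and> binary_word w \<and> no_consecutive_ones w
      \<and> area (bargraph w) = n} = narayana (n + 1)"
    using finite_card_words_of_area[of n] by simp
qed (rule narayana_fps)

end
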